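(* Let $m,q\in\mathbb{N}$ with $q\ge2$ and $0<m<q$, let $p\in(0,2]$, let $f(z)=\sum_{n=0}^{\infty} a_n z^n\in\mathcal{B}$, and let $\omega\in\mathcal{B}_m$. Then for arbitrary $\lambda\in(0,\infty)$ and $z\in\mathbb{D}$ with $|z|=r$, $$F_f(z):=|f(\omega(z))|^p+\lambda\sum_{k=1}^\infty|a_{qk+m}|r^{qk+m}\le1\quad\text{for } r\le R^{p}_{\lambda,q,m},$$ where $R^{p}_{\lambda,q,m}$ is the minimal positive root in the interval $[0,1]$ of the equation $\Psi_5(r)=0$, with $$\Psi_5(r):=2\lambda\frac{r^{q+m}}{1-r^q}-p\,\frac{1-r^m}{1+r^m}.$$ Moreover, in the case when $\Psi_5(r)>0$ in some interval $(R^{p}_{\lambda,q,m},R^{p}_{\lambda,q,m}+\varepsilon)$ with $\varepsilon>0$, the number $R^{p}_{\lambda,q,m}$ cannot be improved.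
   Context: $\mathbb{D}=\{z\in\mathbb{C}:|z|<1\}$ and $\mathbb{N}=\{1,2,\ldots\}$. $\mathcal{B}$ is the set of analytic functions $f$ on $\mathbb{D}$ with $\sup_{z\in\mathbb{D}}|f(z)|\le 1$. For $m\in\mathbb{N}$, $\mathcal{B}_m=\{\omega\in\mathcal{B}:\omega(0)=\cdots=\omega^{(m-1)}(0)=0,\ \omega^{(m)}(0)\ne0\}$. "The number $R^{p}_{\lambda,q,m}$ cannot be improved" means that, for the given $m,q,p,\lambda$, it cannot be replaced by a larger number: for every $R'\in(R^{p}_{\lambda,q,m},1]$ there exist $f\in\mathcal{B}$, $\omega\in\mathcal{B}_m$ and $z$ with $|z|=r<R'$ such that $F_f(z)>1$. *)

theory Defs
  imports "HOL-Complex_Analysis.Complex_Analysis"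
begin

definition \<B> :: "(complex \<Rightarrow> complex) set" where
  "\<B> = {f. f analytic_on ball 0 1 \<and> (\<forall>z\<in>ball 0 1. cmod (f z) \<le> 1)}"

definition \<B>_ord :: "nat \<Rightarrow> (complex \<Rightarrow> complex) set" where
  "\<B>_ord m = {\<omega> \<in> \<B>. (\<forall>k<m. (deriv ^^ k) \<omega> 0 = 0) \<and> (deriv ^^ m) \<omega> 0 \<noteq> 0}"

text \<open>
  The coefficients of \<open>f\<close> are those of its Taylor series at \<open>0\<close>. The sum over \<open>k \<ge> 1\<close> is
  reindexed by \<open>Suc k\<close>; it converges for every \<open>f \<in> \<B>\<close> and \<open>cmod z < 1\<close>.
\<close>

definition bohr_sum ::
  "real \<Rightarrow> real \<Rightarrow> nat \<Rightarrow> nat \<Rightarrow> (complex \<Rightarrow> complex) \<Rightarrow> (complex \<Rightarrow> complex) \<Rightarrow> complex \<Rightarrow> real" where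
  "bohr_sum p lam q m f \<omega> z =
     cmod (f (\<omega> z)) powr p +
     lam * (\<Sum>k. cmod (fps_nth (fps_expansion f 0) (q * Suc k + m)) * cmod z ^ (q * Suc k + m))"

definition Psi5 :: "real \<Rightarrow> real \<Rightarrow> nat \<Rightarrow> nat \<Rightarrow> real \<Rightarrow> real" where
  "Psi5 p lam q m r =
     2 * lam * (r ^ (q + m) / (1 - r ^ q)) - p * ((1 - r ^ m) / (1 + r ^ m))"

text \<open>
  The first term of \<open>Psi5\<close> has a pole at \<open>r = 1\<close>, so \<open>1\<close> is not a root. It must be
  excluded explicitly because division by zero makes the formal value of \<open>Psi5\<close> there \<open>0\<close>.
\<close>

definition is_min_root :: "real \<Rightarrow> real \<Rightarrow> nat \<Rightarrow> nat \<Rightarrow> real \<Rightarrow> bool" where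
  "is_min_root p lam q m R \<longleftrightarrow>
     0 < R \<and> R < 1 \<and> Psi5 p lam q m R = 0 \<and>
     (\<forall>r. 0 < r \<and> r < 1 \<and> Psi5 p lam q m r = 0 \<longrightarrow> R \<le> r)"

definition bohr_radius :: "real \<Rightarrow> real \<Rightarrow> nat \<Rightarrow> nat \<Rightarrow> real" where
  "bohr_radius p lam q m = (THE R. is_min_root p lam q m R)"

end

theory Submission
  imports Defs
begin

text \<open>
  Put \<open>a = |f 0|\<close> and \<open>x = r\<^sup>m\<close>. The Schwarz lemma gives \<open>|\<omega> z| \<le> x\<close>, the Schwarz-Pick lemma gives
  \<open>|f (\<omega> z)| \<le> y\<close> with \<open>y = (x + a) / (1 + a x)\<close>, and the coefficients satisfy
  \<open>|a\<^sub>n| \<le> 1 - a\<^sup>2\<close>. As \<open>p \<le> 2\<close>, concavity gives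
  \<open>y powr p \<le> 1 - (p/2) (1 - y\<^sup>2) \<le> 1 - (p/2) (1 - a\<^sup>2) (1 - x) / (1 + x)\<close>, so that
  \<open>F\<^sub>f(z) - 1\<close> is at most \<open>(1 - a\<^sup>2) / 2\<close> times \<open>Psi5 r\<close>. Since \<open>Psi5\<close> is strictly increasing
  on \<open>(0, 1)\<close>, this is nonpositive up to its only root. Beyond the root, Moebius maps with
  \<open>a\<close> close to \<open>1\<close> exceed the bound.
\<close>

section \<open>The class \<open>\<B>\<close> and its Taylor series\<close>

lemma \<B>_holomorphic: "f \<in> \<B> \<Longrightarrow> f holomorphic_on ball 0 1"
  by (simp add: \<B>_def analytic_on_open)

lemma \<B>_cmod_le: "f \<in> \<B> \<Longrightarrow> cmod z < 1 \<Longrightarrow> cmod (f z) \<le> 1"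
  by (simp add: \<B>_def)

lemma \<B>_I:
  assumes "f holomorphic_on ball 0 1" "\<And>z. cmod z < 1 \<Longrightarrow> cmod (f z) \<le> 1"
  shows "f \<in> \<B>"
  using assms by (simp add: \<B>_def analytic_on_open)

lemma \<B>_has_fps_expansion: "f \<in> \<B> \<Longrightarrow> f has_fps_expansion fps_expansion f 0"
  by (rule has_fps_expansion_fps_expansion[of "ball 0 1"]) (auto dest: \<B>_holomorphic)

lemma \<B>_fps_conv_radius: "f \<in> \<B> \<Longrightarrow> fps_conv_radius (fps_expansion f 0) \<ge> 1"
  using holomorphic_on_imp_fps_conv_radius_ge[OF \<B>_has_fps_expansion, of f 1] \<B>_holomorphic
  by (simp add: one_ereal_def)

lemma \<B>_sums:
  assumes "f \<in> \<B>" "cmod z < 1"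
  shows "(\<lambda>n. fps_nth (fps_expansion f 0) n * z ^ n) sums f z"
  using has_fps_expansion_imp_sums_complex[OF \<B>_has_fps_expansion, of f 1 z] assms \<B>_holomorphic
  by (simp add: one_ereal_def)

lemma eval_fps_in_\<B>:
  assumes "fps_conv_radius F \<ge> 1" "\<And>z. cmod z < 1 \<Longrightarrow> cmod (eval_fps F z) \<le> 1"
  shows "eval_fps F \<in> \<B>"
proof (rule \<B>_I)
  have "ball (0::complex) 1 \<subseteq> eball 0 (fps_conv_radius F)"
  proof
    fix z :: complex assume "z \<in> ball 0 1"
    then have "ereal (cmod z) < 1" by simp
    then have "ereal (cmod z) < fps_conv_radius F"
      using assms(1) by (rule order.strict_trans2)
    then show "z \<in> eball 0 (fps_conv_radius F)"
      by (simp add: in_eball_iff)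
  qed
  then show "eval_fps F holomorphic_on ball 0 1"
    by (rule holomorphic_on_eval_fps)
qed (rule assms(2))

lemma \<B>_fps_nth_0: "fps_nth (fps_expansion f 0) 0 = f 0"
  by (simp add: fps_expansion_def)

section \<open>Schwarz-Pick estimates at the origin\<close>

text \<open>The Schwarz lemma is applied to the dilation \<open>t f\<close> with \<open>t < 1\<close>, which maps into the open
  disc; then \<open>t\<close> tends to \<open>1\<close>.\<close>

lemma Schwarz_Pick_0:
  assumes f: "f \<in> \<B>" and z: "cmod z < 1"
  shows "cmod (f z - f 0) \<le> cmod z * cmod (1 - cnj (f 0) * f z)"
proof -
  have lt: "cmod (t * f z - t * f 0) \<le> cmod z * cmod (1 - cnj (t * f 0) * (t * f z))"
    if t: "0 < t" "t < 1" for t :: real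
  proof -
    have bd: "cmod (t * f w) < 1" if "cmod w < 1" for w
    proof -
      have "t * cmod (f w) \<le> t"
        using \<B>_cmod_le[OF f that] t by (simp add: mult_left_le)
      also note \<open>t < 1\<close>
      finally show ?thesis using t by (simp add: norm_mult)
    qed
    define M where "M = Moebius_function 0 (t * f 0)"
    have holf: "(\<lambda>w. t * f w) holomorphic_on ball 0 1"
      by (intro holomorphic_intros \<B>_holomorphic f)
    have "M holomorphic_on ball 0 1"
      unfolding M_def using bd[of 0] by (intro Moebius_function_holomorphic) auto
    then have "(M \<circ> (\<lambda>w. t * f w)) holomorphic_on ball 0 1"
      by (rule holomorphic_on_compose_gen[OF holf]) (use bd in auto)
    moreover have "(M \<circ> (\<lambda>w. t * f w)) 0 = 0"
      by (simp add: M_def Moebius_function_eq_zero)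
    moreover have "cmod ((M \<circ> (\<lambda>w. t * f w)) w) < 1" if "cmod w < 1" for w
      unfolding M_def o_def using bd[of 0] bd[OF that] by (intro Moebius_function_norm_lt_1) auto
    ultimately have "cmod ((M \<circ> (\<lambda>w. t * f w)) z) \<le> cmod z"
      using z by (rule Schwarz_Lemma(1))
    then have le: "cmod (t * f z - t * f 0) / cmod (1 - cnj (t * f 0) * (t * f z)) \<le> cmod z"
      by (simp add: M_def Moebius_function_simple norm_divide)
    have "cmod (cnj (t * f 0) * (t * f z)) < 1"
      unfolding norm_mult[of "cnj _"] complex_mod_cnj
      using bd[OF z] bd[of 0] norm_mult_less[of "t * f 0" 1 "t * f z" 1] by (simp add: norm_mult)
    then have "1 - cnj (t * f 0) * (t * f z) \<noteq> 0"
      by force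
    then show ?thesis using le by (simp add: divide_le_eq)
  qed
  have ev: "eventually (\<lambda>t::real. cmod (t * f z - t * f 0) \<le> cmod z * cmod (1 - cnj (t * f 0) * (t * f z)))
      (at_left 1)"
    using eventually_at_left_real[OF zero_less_one] by (rule eventually_mono, intro lt) auto
  have "((\<lambda>t::real. cmod (t * f z - t * f 0)) \<longlongrightarrow> cmod (of_real 1 * f z - of_real 1 * f 0)) (at_left 1)"
    by (intro tendsto_intros)
  moreover have "((\<lambda>t::real. cmod z * cmod (1 - cnj (t * f 0) * (t * f z))) \<longlongrightarrow>
      cmod z * cmod (1 - cnj (of_real 1 * f 0) * (of_real 1 * f z))) (at_left 1)"
    by (intro tendsto_intros)
  ultimately show ?thesis
    using tendsto_le[OF _ _ _ ev] by (simp add: trivial_limit_at_left_real)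
qed

text \<open>Dividing \<open>Schwarz_Pick_0\<close> by \<open>cmod z\<close> and letting
  \<open>z\<close> tend to \<open>0\<close> turns the difference quotient into the derivative. This
  is the coefficient bound for the first coefficient, from which the one for every index is
  derived.\<close>

lemma Schwarz_Pick_deriv_0:
  assumes f: "f \<in> \<B>"
  shows "cmod (deriv f 0) \<le> 1 - (cmod (f 0))\<^sup>2"
proof -
  have "f field_differentiable at 0"
    using \<B>_holomorphic[OF f] by (rule holomorphic_on_imp_differentiable_at) auto
  then have D: "(f has_field_derivative deriv f 0) (at 0)"
    by (simp add: field_differentiable_derivI)
  then have "((\<lambda>z. (f z - f 0) / z) \<longlongrightarrow> deriv f 0) (at 0)"
    by (simp add: has_field_derivative_iff)
  then have lim1: "((\<lambda>z. cmod ((f z - f 0) / z)) \<longlongrightarrow> cmod (deriv f 0)) (at 0)"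
    by (rule tendsto_norm)
  have "(f \<longlongrightarrow> f 0) (at 0)"
    using DERIV_isCont[OF D] by (simp add: isCont_def)
  then have lim2: "((\<lambda>z. cmod (1 - cnj (f 0) * f z)) \<longlongrightarrow> cmod (1 - cnj (f 0) * f 0)) (at 0)"
    by (intro tendsto_intros)
  have "eventually (\<lambda>z. z \<in> ball 0 1 - {0}) (at (0::complex))"
    by (rule eventually_at_in_open) auto
  then have ev: "eventually (\<lambda>z. cmod ((f z - f 0) / z) \<le> cmod (1 - cnj (f 0) * f z)) (at 0)"
    by (rule eventually_mono) (use Schwarz_Pick_0[OF f] in \<open>auto simp: norm_divide divide_le_eq mult.commute\<close>)
  have "cmod (deriv f 0) \<le> cmod (1 - cnj (f 0) * f 0)"
    by (rule tendsto_le[OF _ lim2 lim1 ev]) auto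
  also have "1 - cnj (f 0) * f 0 = of_real (1 - (cmod (f 0))\<^sup>2)"
    using complex_norm_square[of "f 0"] by (simp add: mult.commute)
  also have "cmod \<dots> = 1 - (cmod (f 0))\<^sup>2"
    unfolding norm_of_real using \<B>_cmod_le[OF f, of 0] by (simp add: abs_square_le_1)
  finally show ?thesis .
qed

text \<open>After squaring, \<open>Schwarz_Pick_0\<close> involves only \<open>a\<close>,
  \<open>b\<close>, \<open>x\<close> and the real part \<open>c\<close>. Replacing \<open>c\<close>
  by its upper bound \<open>a * b\<close> makes both sides perfect squares, and the square root
  leaves an inequality linear in \<open>b\<close>.\<close>

lemma Schwarz_Pick_cmod_le:
  assumes f: "f \<in> \<B>" and z: "cmod z < 1"
  shows "cmod (f z) \<le> (cmod z + cmod (f 0)) / (1 + cmod (f 0) * cmod z)"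
proof -
  define a b x where "a = cmod (f 0)" and "b = cmod (f z)" and "x = cmod z"
  define c where "c = Re (cnj (f 0) * f z)"
  have a: "0 \<le> a" "a \<le> 1" and b: "0 \<le> b" "b \<le> 1" and x: "0 \<le> x" "x < 1"
    using \<B>_cmod_le[OF f, of 0] \<B>_cmod_le[OF f z] z by (auto simp: a_def b_def x_def)
  have c: "c \<le> a * b"
    using complex_Re_le_cmod[of "cnj (f 0) * f z"] by (simp add: a_def b_def c_def norm_mult)
  have 1: "(cmod (f z - f 0))\<^sup>2 = b\<^sup>2 + a\<^sup>2 - 2 * c"
    unfolding a_def b_def c_def cmod_power2 by (simp add: algebra_simps power2_eq_square)
  have 2: "(cmod (1 - cnj (f 0) * f z))\<^sup>2 = 1 + a\<^sup>2 * b\<^sup>2 - 2 * c"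
    unfolding a_def b_def c_def cmod_power2 by (simp add: algebra_simps power2_eq_square)
  have "(cmod (f z - f 0))\<^sup>2 \<le> (x * cmod (1 - cnj (f 0) * f z))\<^sup>2"
    using Schwarz_Pick_0[OF f z] by (intro power_mono) (auto simp: x_def)
  then have "b\<^sup>2 + a\<^sup>2 - 2 * c \<le> x\<^sup>2 * (1 + a\<^sup>2 * b\<^sup>2 - 2 * c)"
    by (simp add: 1 2 power_mult_distrib)
  \<comment> \<open>Twice this product is exactly the slack gained by passing from \<open>c\<close>
    to \<open>a * b\<close> on both sides.\<close>
  moreover have "0 \<le> (1 - x\<^sup>2) * (a * b - c)"
    using c x by (intro mult_nonneg_nonneg) (auto simp: power_le_one)
  ultimately have "(b - a)\<^sup>2 \<le> (x * (1 - a * b))\<^sup>2"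
    by (simp add: algebra_simps power2_eq_square)
  then have "b - a \<le> x * (1 - a * b)"
    by (rule power2_le_imp_le) (use a b x in \<open>simp add: mult_le_one\<close>)
  then have "b * (1 + a * x) \<le> x + a"
    by (simp add: algebra_simps)
  moreover have "0 < 1 + a * x"
    using a x by (simp add: add_pos_nonneg)
  ultimately show ?thesis
    by (simp add: pos_le_divide_eq a_def b_def x_def)
qed

section \<open>Coefficient bounds by averaging over roots of unity\<close>

text \<open>With the roles of \<open>j\<close> and \<open>k\<close> exchanged this is a geometric
  sum of ratio \<open>w\<close>, where \<open>w ^ n = 1\<close>; it vanishes unless
  \<open>w = 1\<close>. It serves as the filter that selects the coefficients with index divisible
  by \<open>n\<close>.\<close>

lemma root_unity_power_sum:
  fixes n k :: nat
  assumes "n \<ge> 1"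
  shows "(\<Sum>j<n. exp (2 * of_real pi * \<i> * of_nat j / of_nat n) ^ k) = (if n dvd k then of_nat n else 0)"
proof -
  define w where "w = exp (2 * of_real pi * \<i> * of_nat k / of_nat n)"
  have w: "exp (2 * of_real pi * \<i> * of_nat j / of_nat n) ^ k = w ^ j" for j
    by (simp add: w_def exp_of_nat_mult[symmetric] mult_ac)
  have eq1: "w = 1 \<longleftrightarrow> n dvd k"
    unfolding w_def by (rule complex_root_unity_eq_1[OF assms])
  have "w ^ n = 1"
    unfolding w_def by (rule complex_root_unity) (use assms in auto)
  then show ?thesis
    using eq1 by (auto simp: w geometric_sum)
qed

text \<open>Averaging \<open>f\<close> over the rotations by \<open>n\<close>-th roots of unity leaves the coefficients whose
  index is divisible by \<open>n\<close>; as a function of \<open>z ^ n\<close> the average has derivative \<open>a\<^sub>n\<close> at \<open>0\<close>.\<close>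

lemma \<B>_fps_nth_le:
  assumes f: "f \<in> \<B>" and n: "n \<ge> 1"
  shows "cmod (fps_nth (fps_expansion f 0) n) \<le> 1 - (cmod (f 0))\<^sup>2"
proof -
  define c where "c = fps_nth (fps_expansion f 0)"
  define \<zeta> where "\<zeta> = (\<lambda>j::nat. exp (2 * of_real pi * \<i> * of_nat j / of_nat n))"
  have norm_\<zeta>: "cmod (\<zeta> j) = 1" for j
    by (simp add: \<zeta>_def norm_exp_eq_Re)
  have n0: "n > 0" using n by simp
  define H where "H = Abs_fps (\<lambda>k. c (n * k))"
  have sums_avg: "(\<lambda>k. c (n * k) * (z ^ n) ^ k) sums ((\<Sum>j<n. f (\<zeta> j * z)) / of_nat n)"
    if z: "cmod z < 1" for z
  proof -
    have "(\<lambda>k. c k * (\<zeta> j * z) ^ k) sums f (\<zeta> j * z)" for j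
      unfolding c_def by (rule \<B>_sums[OF f]) (simp add: norm_mult norm_\<zeta> z)
    then have "(\<lambda>k. (\<Sum>j<n. c k * (\<zeta> j * z) ^ k) / of_nat n) sums ((\<Sum>j<n. f (\<zeta> j * z)) / of_nat n)"
      by (intro sums_divide sums_sum) auto
    moreover have "(\<Sum>j<n. c k * (\<zeta> j * z) ^ k) / of_nat n = (if n dvd k then c k * z ^ k else 0)" for k
    proof -
      have "(\<Sum>j<n. c k * (\<zeta> j * z) ^ k) = c k * z ^ k * (\<Sum>j<n. \<zeta> j ^ k)"
        by (simp add: sum_distrib_left power_mult_distrib mult_ac)
      then show ?thesis
        using n0 unfolding \<zeta>_def root_unity_power_sum[OF n] by auto
    qed
    ultimately have "(\<lambda>k. if n dvd k then c k * z ^ k else 0) sums ((\<Sum>j<n. f (\<zeta> j * z)) / of_nat n)"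
      by simp
    \<comment> \<open>All terms off the multiples of \<open>n\<close> are zero, so the series may be
      summed along this subsequence.\<close>
    moreover have "strict_mono (\<lambda>k. n * k)"
      using n0 by (simp add: strict_mono_def)
    ultimately have "(\<lambda>k. if n dvd n * k then c (n * k) * z ^ (n * k) else 0) sums ((\<Sum>j<n. f (\<zeta> j * z)) / of_nat n)"
      by (subst sums_mono_reindex) (auto simp: dvd_def)
    then show ?thesis
      by (simp add: power_mult)
  qed
  \<comment> \<open>The average only describes \<open>H\<close> at \<open>n\<close>-th powers; since
    these fill the disc, convergence and the bound by \<open>1\<close> pass to \<open>H\<close> on
    the whole disc.\<close>
  have root: "\<exists>z. cmod z < 1 \<and> w = z ^ n" if "cmod w < 1" for w
  proof -
    obtain z where "w = z ^ n"
      using exists_complex_root[of n w] n0 by auto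
    moreover have "cmod z < 1"
    proof (rule ccontr)
      assume "\<not> cmod z < 1"
      then have "1 \<le> cmod z ^ n" by simp
      then show False using that \<open>w = z ^ n\<close> by (simp add: norm_power)
    qed
    ultimately show ?thesis by blast
  qed
  have summ: "summable (\<lambda>k. fps_nth H k * w ^ k)" if "cmod w < 1" for w
    using root[OF that] sums_avg by (auto simp: H_def summable_def)
  have rad: "fps_conv_radius H \<ge> 1"
    unfolding fps_conv_radius_def by (rule conv_radius_geI_ex') (auto intro!: summ)
  have H_\<B>: "eval_fps H \<in> \<B>"
  proof (rule eval_fps_in_\<B>[OF rad])
    fix w assume "cmod w < 1"
    then obtain z where z: "cmod z < 1" "w = z ^ n" using root by blast
    have "eval_fps H w = (\<Sum>j<n. f (\<zeta> j * z)) / of_nat n"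
      using sums_avg[OF z(1)] by (simp add: eval_fps_def H_def z(2) sums_iff)
    moreover have "cmod (\<Sum>j<n. f (\<zeta> j * z)) \<le> (\<Sum>j<n. 1)"
      by (intro sum_norm_le \<B>_cmod_le[OF f]) (simp add: norm_mult norm_\<zeta> z)
    ultimately show "cmod (eval_fps H w) \<le> 1"
      using n0 by (simp add: norm_divide)
  qed
  have "fps_conv_radius H > 0"
    using rad by (rule less_le_trans[rotated]) simp
  then have "fps_expansion (eval_fps H) 0 = H"
    by (intro fps_expansion_eqI eval_fps_has_fps_expansion)
  then have "fps_nth H k = (deriv ^^ k) (eval_fps H) 0 / fact k" for k
    by (metis fps_expansion_def fps_nth_Abs_fps)
  from this[of 0] this[of 1] have "fps_nth H 0 = eval_fps H 0" "fps_nth H 1 = deriv (eval_fps H) 0"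
    by simp_all
  moreover have "fps_nth H 0 = f 0" "fps_nth H 1 = c n"
    by (simp_all add: H_def c_def \<B>_fps_nth_0)
  ultimately show ?thesis
    using Schwarz_Pick_deriv_0[OF H_\<B>] by (simp add: c_def)
qed

section \<open>Schwarz lemma for zeros of higher order\<close>

text \<open>Induction on \<open>m\<close>, dividing out one factor \<open>z\<close> at a time: since
  \<open>f 0 = 0\<close>, the quotient \<open>G\<close> of \<open>f\<close> by \<open>z\<close> is
  again in \<open>\<B>\<close>, and its coefficients are those of \<open>f\<close> shifted by
  one.\<close>

lemma \<B>_cmod_le_power:
  assumes "f \<in> \<B>" "\<And>k. k < m \<Longrightarrow> fps_nth (fps_expansion f 0) k = 0" "cmod z < 1"
  shows "cmod (f z) \<le> cmod z ^ m"
  using assms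
proof (induction m arbitrary: f)
  case 0
  then show ?case by (simp add: \<B>_cmod_le)
next
  case (Suc m)
  note f = Suc.prems(1)
  define G where "G = fps_shift 1 (fps_expansion f 0)"
  have f0: "f 0 = 0"
    using Suc.prems(2)[of 0] by (simp add: \<B>_fps_nth_0)
  have rad: "fps_conv_radius G \<ge> 1"
    using \<B>_fps_conv_radius[OF f] by (simp add: G_def)
  have f_eq: "f w = w * eval_fps G w" if "cmod w < 1" for w
  proof -
    have "ereal (cmod w) < 1" using that by simp
    then have w: "ereal (cmod w) < fps_conv_radius G"
      using rad by (rule order.strict_trans2)
    have "(\<lambda>n. fps_nth G n * w ^ n) sums eval_fps G w"
      by (rule sums_eval_fps[OF w])
    then have "(\<lambda>n. w * (fps_nth G n * w ^ n)) sums (w * eval_fps G w)"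
      by (rule sums_mult)
    moreover have "(\<lambda>n. fps_nth (fps_expansion f 0) (Suc n) * w ^ Suc n) sums (f w - f 0)"
      using \<B>_sums[OF f that] by (subst sums_Suc_iff) (simp add: \<B>_fps_nth_0)
    ultimately show ?thesis
      by (simp add: G_def f0 mult_ac sums_unique2)
  qed
  have "fps_conv_radius G > 0"
    using rad by (rule less_le_trans[rotated]) simp
  then have exp_G: "fps_expansion (eval_fps G) 0 = G"
    by (intro fps_expansion_eqI eval_fps_has_fps_expansion)
  have "eval_fps G \<in> \<B>"
  proof (rule eval_fps_in_\<B>[OF rad])
    fix w assume w: "cmod w < 1"
    show "cmod (eval_fps G w) \<le> 1"
    \<comment> \<open>The factor \<open>w\<close> cannot be cancelled at the origin; there the value
      of \<open>G\<close> is the first coefficient of \<open>f\<close>, which the coefficient bound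
      controls.\<close>
    proof (cases "w = 0")
      case True
      then have "eval_fps G w = fps_nth (fps_expansion f 0) 1"
        by (simp add: G_def eval_fps_at_0)
      then show ?thesis using \<B>_fps_nth_le[OF f, of 1] f0 by simp
    next
      case False
      have "cmod (w * eval_fps G w) \<le> cmod w"
        using Schwarz_Pick_0[OF f w] by (simp add: f0 f_eq[OF w])
      then show ?thesis using False by (simp add: norm_mult)
    qed
  qed
  moreover have "fps_nth (fps_expansion (eval_fps G) 0) k = 0" if "k < m" for k
    using Suc.prems(2)[of "Suc k"] that by (simp add: exp_G) (simp add: G_def)
  ultimately have "cmod (eval_fps G z) \<le> cmod z ^ m"
    using Suc.IH Suc.prems(3) by blast
  then show ?case
    using f_eq[OF Suc.prems(3)] by (simp add: norm_mult mult_left_mono)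
qed

lemma \<B>_ord_cmod_le:
  assumes "\<omega> \<in> \<B>_ord m" "cmod z < 1"
  shows "cmod (\<omega> z) \<le> cmod z ^ m"
  using assms by (intro \<B>_cmod_le_power) (auto simp: \<B>_ord_def fps_expansion_def)

section \<open>Real inequalities for the first term\<close>

text \<open>As \<open>p / 2 \<le> 1\<close>, the function \<open>t powr (p / 2)\<close> is concave
  and lies below its tangent at \<open>t = 1\<close>; here \<open>t = y\<^sup>2\<close>. The proof
  is the weighted arithmetic-geometric mean inequality for \<open>y\<^sup>2\<close> and
  \<open>1\<close>.\<close>

lemma powr_le_tangent_square:
  fixes y p :: real
  assumes "0 \<le> y" "0 < p" "p \<le> 2"
  shows "y powr p \<le> 1 - p / 2 * (1 - y\<^sup>2)"
proof (cases "y = 0")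
  case True
  then show ?thesis using assms by simp
next
  case False
  then have "y > 0" using assms by simp
  then have "y powr p = (y\<^sup>2) powr (p / 2) * 1 powr (1 - p / 2)"
    by (simp add: powr_powr flip: powr_numeral)
  also have "\<dots> \<le> p / 2 * y\<^sup>2 + (1 - p / 2) * 1"
    by (rule Youngs_inequality_0) (use assms \<open>y > 0\<close> in auto)
  finally show ?thesis by (simp add: algebra_simps)
qed

text \<open>The identity for \<open>1 - y\<^sup>2\<close> isolates the factor
  \<open>1 - a\<^sup>2\<close>, which also occurs in the coefficient bound. Replacing
  \<open>1 + a * x\<close> by the larger \<open>1 + x\<close> then removes \<open>a\<close> from
  what remains.\<close>

lemma powr_Moebius_le:
  fixes a x p :: real
  assumes "0 \<le> a" "a \<le> 1" "0 \<le> x" "x < 1" "0 < p" "p \<le> 2"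
  shows "((x + a) / (1 + a * x)) powr p \<le> 1 - p / 2 * (1 - a\<^sup>2) * ((1 - x) / (1 + x))"
proof -
  define y where "y = (x + a) / (1 + a * x)"
  have pos: "0 < 1 + a * x" using assms by (simp add: add_pos_nonneg)
  have "1 - y\<^sup>2 = (1 - a\<^sup>2) * ((1 - x\<^sup>2) / (1 + a * x)\<^sup>2)"
    using pos unfolding y_def power_divide by (simp add: divide_simps) algebra
  moreover have "(1 - x) / (1 + x) \<le> (1 - x\<^sup>2) / (1 + a * x)\<^sup>2"
  proof -
    have "(1 + a * x)\<^sup>2 \<le> (1 + x)\<^sup>2"
      using assms pos by (intro power_mono) (auto simp: mult_left_le_one_le)
    then have "(1 - x\<^sup>2) / (1 + x)\<^sup>2 \<le> (1 - x\<^sup>2) / (1 + a * x)\<^sup>2"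
      using assms pos by (intro divide_left_mono) (auto simp: power_le_one)
    moreover have "(1 - x\<^sup>2) / (1 + x)\<^sup>2 = (1 - x) / (1 + x)"
      using assms by (simp add: divide_simps) algebra
    ultimately show ?thesis by simp
  qed
  moreover have "0 \<le> 1 - a\<^sup>2"
    using assms by (simp add: power_le_one)
  ultimately have "(1 - a\<^sup>2) * ((1 - x) / (1 + x)) \<le> 1 - y\<^sup>2"
    by (metis mult_left_mono)
  then have "p / 2 * ((1 - a\<^sup>2) * ((1 - x) / (1 + x))) \<le> p / 2 * (1 - y\<^sup>2)"
    using assms by (intro mult_left_mono) auto
  moreover have "y powr p \<le> 1 - p / 2 * (1 - y\<^sup>2)"
    using assms pos by (intro powr_le_tangent_square) (auto simp: y_def)
  ultimately show ?thesis
    unfolding y_def mult.assoc by linarith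
qed

section \<open>Monotonicity and the unique root of \<open>Psi5\<close>\<close>

text \<open>In the first fraction the numerator grows while the positive denominator shrinks, and
  \<open>(1 - t) / (1 + t)\<close> decreases in \<open>t\<close>. This yields both uniqueness of the
  root and the sign of \<open>Psi5\<close> on either side of it.\<close>

lemma Psi5_strict_mono:
  assumes "0 < p" "0 < lam" "0 < m" "0 < q" "0 < r" "r < s" "s < 1"
  shows "Psi5 p lam q m r < Psi5 p lam q m s"
proof -
  have rm: "r ^ m < s ^ m" "r ^ m < 1" "0 < r ^ m" and sm: "s ^ m < 1"
    and rq: "r ^ q < s ^ q" and sq: "s ^ q < 1" and rqm: "r ^ (q + m) < s ^ (q + m)" "0 < r ^ (q + m)"
    using assms by (auto intro!: power_strict_mono power_Suc_less_one simp: power_less_one_iff)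
  have "r ^ (q + m) / (1 - r ^ q) < s ^ (q + m) / (1 - s ^ q)"
    using rq sq rqm by (intro frac_less) auto
  moreover have "(1 - s ^ m) / (1 + s ^ m) < (1 - r ^ m) / (1 + r ^ m)"
    using rm sm by (simp add: divide_simps algebra_simps)
  ultimately show ?thesis
    unfolding Psi5_def using assms by (intro diff_strict_mono mult_strict_left_mono) auto
qed

text \<open>Existence comes from the intermediate value theorem, uniqueness from strict
  monotonicity; together they make the definite description in \<open>bohr_radius\<close>
  meaningful.\<close>

lemma is_min_root_bohr_radius:
  assumes "0 < p" "0 < lam" "0 < m" "0 < q"
  shows "is_min_root p lam q m (bohr_radius p lam q m)"
proof -
  \<comment> \<open>\<open>Psi5\<close> with its denominators cleared, hence continuous up to
    \<open>1\<close>. It equals \<open>- p\<close> at \<open>0\<close> and \<open>4 * lam\<close> at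
    \<open>1\<close>.\<close>
  define H where "H = (\<lambda>r::real. 2 * lam * r ^ (q + m) * (1 + r ^ m) - p * (1 - r ^ m) * (1 - r ^ q))"
  have "\<exists>r\<ge>0. r \<le> 1 \<and> H r = 0"
    by (rule IVT') (use assms in \<open>auto simp: H_def power_0_left intro!: continuous_intros\<close>)
  then obtain R where R: "0 \<le> R" "R \<le> 1" "H R = 0" by blast
  have "R \<noteq> 0" "R \<noteq> 1"
    using R assms by (auto simp: H_def power_0_left)
  then have R01: "0 < R" "R < 1" using R by auto
  have "R ^ q < 1" "0 < R ^ m"
    using R01 assms by (auto simp: power_less_one_iff)
  then have "Psi5 p lam q m R = H R / ((1 - R ^ q) * (1 + R ^ m))"
    by (simp add: Psi5_def H_def field_simps)
  then have root: "Psi5 p lam q m R = 0" using R by simp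
  have eq: "r = R" if "0 < r" "r < 1" "Psi5 p lam q m r = 0" for r
    using that R01 root Psi5_strict_mono[OF assms, of r R] Psi5_strict_mono[OF assms, of R r]
    by (cases r R rule: linorder_cases) auto
  then have "R \<le> r" if "0 < r \<and> r < 1 \<and> Psi5 p lam q m r = 0" for r
    using that by blast
  then have "is_min_root p lam q m R"
    using R01 root by (simp add: is_min_root_def)
  moreover have "r = R" if "is_min_root p lam q m r" for r
    using that unfolding is_min_root_def by (intro eq) auto
  ultimately show ?thesis
    unfolding bohr_radius_def by (rule theI)
qed

lemma sums_gap_geometric:
  fixes r :: real
  assumes "0 \<le> r" "r < 1" "0 < q"
  shows "(\<lambda>k. r ^ (q * Suc k + m)) sums (r ^ (q + m) / (1 - r ^ q))"
proof -
  have "norm (r ^ q) < 1" using assms by (simp add: power_less_one_iff)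
  then have "(\<lambda>k. r ^ (q + m) * (r ^ q) ^ k) sums (r ^ (q + m) * (1 / (1 - r ^ q)))"
    by (intro sums_mult geometric_sums)
  then show ?thesis
    by (simp add: power_add mult_ac flip: power_mult)
qed

section \<open>Moebius maps and the choice of their parameter\<close>

text \<open>Subtracting the constant term \<open>a\<close> leaves
  \<open>(1 - a\<^sup>2) * z / (1 + a * z)\<close>, a geometric series in
  \<open>- a * z\<close>.\<close>

lemma Moebius_fps_nth:
  fixes a :: complex
  assumes "cmod a < 1"
  shows "fps_nth (fps_expansion (\<lambda>z. (z + a) / (1 + a * z)) 0) (Suc n) = (1 - a\<^sup>2) * (- a) ^ n"
proof -
  define F where "F = Abs_fps (\<lambda>n. case n of 0 \<Rightarrow> a | Suc k \<Rightarrow> (1 - a\<^sup>2) * (- a) ^ k)"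
  have "(\<lambda>n. fps_nth F n * z ^ n) sums ((z + a) / (1 + a * z))" if z: "cmod z < 1" for z
  proof -
    have "cmod (- a * z) < 1"
      using norm_mult_less[of a 1 z 1] assms z by simp
    moreover from this have "1 + a * z \<noteq> 0"
      by (metis add_eq_0_iff2 mult_minus_left norm_one order_less_irrefl)
    ultimately have "(\<lambda>n. (1 - a\<^sup>2) * z * (- a * z) ^ n) sums ((1 - a\<^sup>2) * z * (1 / (1 - (- a * z))))"
      by (intro sums_mult geometric_sums)
    also have "(1 - a\<^sup>2) * z * (1 / (1 - (- a * z))) = (z + a) / (1 + a * z) - a"
      using \<open>1 + a * z \<noteq> 0\<close> by (simp add: field_simps power2_eq_square)
    finally have "(\<lambda>n. fps_nth F (Suc n) * z ^ Suc n) sums ((z + a) / (1 + a * z) - a)"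
      unfolding power_mult_distrib by (simp add: F_def mult_ac)
    then show ?thesis
      by (subst (asm) sums_Suc_iff) (simp add: F_def)
  qed
  then have "eventually (\<lambda>z. (\<lambda>n. fps_nth F n * z ^ n) sums ((z + a) / (1 + a * z))) (nhds 0)"
    using eventually_nhds_in_open[of "ball 0 1" "0::complex"] by (auto elim: eventually_mono)
  then have "fps_expansion (\<lambda>z. (z + a) / (1 + a * z)) 0 = F"
    by (intro fps_expansion_eqI has_fps_expansionI)
  then show ?thesis by (simp add: F_def)
qed

text \<open>Along \<open>f z = (z + a) / (1 + a z)\<close>, \<open>\<omega> z = z ^ m\<close> and \<open>z = r\<close>, the functional equals \<open>1\<close>
  at \<open>a = 1\<close> and its derivative in \<open>a\<close> there is \<open>- Psi5 r\<close>.\<close>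

lemma exists_Moebius_parameter:
  assumes "0 < m" "0 < q" "0 < r" "r < 1" "Psi5 p lam q m r > 0"
  shows "\<exists>a. 0 < a \<and> a < 1 \<and> 1 < ((r ^ m + a) / (1 + a * r ^ m)) powr p +
    lam * ((1 - a\<^sup>2) * a ^ (q + m - 1) * (r ^ (q + m) / (1 - (a * r) ^ q)))"
proof -
  define x where "x = r ^ m"
  define S where "S = r ^ (q + m)"
  have x: "0 < x" "x < 1" and rq: "r ^ q < 1"
    using assms by (auto simp: x_def power_less_one_iff)
  define y where "y = (\<lambda>a. (x + a) / (1 + a * x))"
  define T where "T = (\<lambda>a. a ^ (q + m - 1) * (S / (1 - (a * r) ^ q)))"
  define G where "G = (\<lambda>a. y a powr p + lam * ((1 - a\<^sup>2) * T a))"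
  have y1: "y 1 = 1" using x by (simp add: y_def add.commute)
  have dy: "(y has_real_derivative (1 - x) / (1 + x)) (at 1)"
    unfolding y_def
    by (rule derivative_eq_intros refl | use x in force)+ (use x in \<open>simp add: divide_simps, simp add: algebra_simps\<close>)
  have dpow: "((\<lambda>a. y a powr p) has_real_derivative p * ((1 - x) / (1 + x))) (at 1)"
    by (rule DERIV_cong[OF DERIV_fun_powr[OF dy]]) (simp_all add: y1)
  \<comment> \<open>The value of this derivative is immaterial: in the product rule at
    \<open>a = 1\<close> it is multiplied by \<open>1 - a\<^sup>2 = 0\<close>.\<close>
  have "\<exists>T'. (T has_real_derivative T') (at 1)"
    unfolding T_def by (rule exI) (rule derivative_eq_intros refl | use rq in force)+
  then obtain T' where dT: "(T has_real_derivative T') (at 1)" by blast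
  have "((\<lambda>a. (1 - a\<^sup>2) * T a) has_real_derivative - 2 * T 1) (at 1)"
    by (rule derivative_eq_intros dT refl)+ simp
  then have dG: "(G has_real_derivative p * ((1 - x) / (1 + x)) + lam * (- 2 * T 1)) (at 1)"
    unfolding G_def by (intro DERIV_add DERIV_cmult dpow)
  have "p * ((1 - x) / (1 + x)) + lam * (- 2 * T 1) = - Psi5 p lam q m r"
    by (simp add: Psi5_def T_def S_def x_def)
  then obtain d where d: "d > 0" "\<And>h. 0 < h \<Longrightarrow> h < d \<Longrightarrow> G 1 < G (1 - h)"
    using DERIV_neg_dec_left[OF dG] assms by auto
  \<comment> \<open>Halving the minimum keeps \<open>h\<close> strictly below both \<open>d\<close>
    and \<open>1\<close>, so \<open>1 - h\<close> is an admissible parameter.\<close>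
  define h where "h = min d 1 / 2"
  have "G 1 < G (1 - h)" "0 < h" "h < 1"
    using d by (auto simp: h_def)
  moreover have "G 1 = 1" by (simp add: G_def y1)
  ultimately show ?thesis
    by (intro exI[of _ "1 - h"]) (simp add: G_def y_def T_def S_def x_def mult_ac)
qed

section \<open>The inequality up to the radius\<close>

text \<open>The amount by which the first term falls short of \<open>1\<close> and the bound for the
  series share the factor \<open>1 - a\<^sup>2\<close>, so the comparison reduces to
  \<open>Psi5 p lam q m r \<le> 0\<close>.\<close>

lemma bohr_sum_le_1:
  assumes "0 < m" "0 < q" "0 < p" "p \<le> 2" "0 < lam"
    and R: "is_min_root p lam q m R" and f: "f \<in> \<B>" and \<omega>: "\<omega> \<in> \<B>_ord m"
    and z: "cmod z \<le> R"
  shows "bohr_sum p lam q m f \<omega> z \<le> 1"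
proof -
  define a r where "a = cmod (f 0)" and "r = cmod z"
  have R01: "0 < R" "R < 1" and root: "Psi5 p lam q m R = 0"
    using R by (auto simp: is_min_root_def)
  have r: "0 \<le> r" "r \<le> R" "r < 1" and a: "0 \<le> a" "a \<le> 1"
    using z R01 \<B>_cmod_le[OF f, of 0] by (auto simp: r_def a_def)
  define c where "c = (\<lambda>k. cmod (fps_nth (fps_expansion f 0) (q * Suc k + m)) * r ^ (q * Suc k + m))"
  define x where "x = r ^ m"
  have x: "0 \<le> x" "x < 1" and Rq: "R ^ q < 1"
    using r R01 assms by (auto simp: x_def power_less_one_iff)
  have \<omega>z: "cmod (\<omega> z) \<le> x"
    using \<B>_ord_cmod_le[OF \<omega>, of z] r by (simp add: x_def r_def)
  have "cmod (f (\<omega> z)) \<le> (cmod (\<omega> z) + a) / (1 + a * cmod (\<omega> z))"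
    using \<omega>z x unfolding a_def by (intro Schwarz_Pick_cmod_le[OF f]) auto
  also have "\<dots> \<le> (x + a) / (1 + a * x)"
  proof -
    define w where "w = cmod (\<omega> z)"
    have pos: "0 < 1 + a * w" "0 < 1 + a * x"
      using a x by (auto simp: w_def intro!: add_pos_nonneg)
    \<comment> \<open>This is the difference of the two cross-multiplied sides, so the Schwarz-Pick
      bound increases with the modulus of \<open>\<omega> z\<close>.\<close>
    have "0 \<le> (1 - a * a) * (x - w)"
      using a \<omega>z by (intro mult_nonneg_nonneg) (auto simp: w_def mult_le_one)
    then have "(w + a) * (1 + a * x) \<le> (x + a) * (1 + a * w)"
      by (simp add: algebra_simps)
    then show ?thesis
      using pos unfolding w_def[symmetric] by (simp add: divide_le_eq pos_le_divide_eq)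
  qed
  finally have "cmod (f (\<omega> z)) powr p \<le> ((x + a) / (1 + a * x)) powr p"
    using assms by (intro powr_mono2) auto
  also have "\<dots> \<le> 1 - p / 2 * (1 - a\<^sup>2) * ((1 - x) / (1 + x))"
    by (rule powr_Moebius_le) (use a x assms in auto)
  finally have first: "cmod (f (\<omega> z)) powr p \<le> 1 - p / 2 * (1 - a\<^sup>2) * ((1 - x) / (1 + x))" .

  have geo: "(\<lambda>k. (1 - a\<^sup>2) * r ^ (q * Suc k + m)) sums ((1 - a\<^sup>2) * (r ^ (q + m) / (1 - r ^ q)))"
    using r assms by (intro sums_mult sums_gap_geometric) auto
  have c_le: "c k \<le> (1 - a\<^sup>2) * r ^ (q * Suc k + m)" for k
    unfolding c_def a_def using r assms by (intro mult_right_mono \<B>_fps_nth_le[OF f]) auto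
  have c_nonneg: "0 \<le> c k" for k
    using r by (simp add: c_def)
  have "summable c"
    by (rule summable_comparison_test'[OF sums_summable[OF geo]]) (use c_nonneg c_le in simp)
  then have "suminf c \<le> (1 - a\<^sup>2) * (r ^ (q + m) / (1 - r ^ q))"
    using suminf_le[OF c_le _ sums_summable[OF geo]] sums_unique[OF geo] by simp
  then have "lam * suminf c \<le> lam * ((1 - a\<^sup>2) * (r ^ (q + m) / (1 - r ^ q)))"
    using assms by (intro mult_left_mono) auto
  also have "\<dots> = (1 - a\<^sup>2) * (lam * (r ^ (q + m) / (1 - r ^ q)))"
    by (rule mult.left_commute)
  also have "\<dots> \<le> (1 - a\<^sup>2) * (p / 2 * ((1 - x) / (1 + x)))"
  proof (rule mult_left_mono)
    have "Psi5 p lam q m r \<le> 0"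
    \<comment> \<open>Monotonicity is available only for positive arguments; at \<open>0\<close> the
      value is \<open>- p\<close>.\<close>
    proof (cases "r = 0")
      case True
      then show ?thesis using assms by (simp add: Psi5_def power_0_left)
    next
      case False
      then have "Psi5 p lam q m r < Psi5 p lam q m R" if "r < R"
        using that assms r R01 by (intro Psi5_strict_mono) simp_all
      then show ?thesis
        using r root by (cases "r = R") simp_all
    qed
    then show "lam * (r ^ (q + m) / (1 - r ^ q)) \<le> p / 2 * ((1 - x) / (1 + x))"
      unfolding Psi5_def x_def by linarith
    show "0 \<le> 1 - a\<^sup>2" using a by (simp add: power_le_one)
  qed
  finally have "lam * suminf c \<le> p / 2 * (1 - a\<^sup>2) * ((1 - x) / (1 + x))"
    by (simp only: mult_ac)
  then show ?thesis
    using first unfolding bohr_sum_def c_def r_def by linarith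
qed

section \<open>Sharpness beyond the radius, and the theorem\<close>

lemma monomial_in_\<B>_ord: "(\<lambda>z. z ^ m) \<in> \<B>_ord m"
proof -
  have "(\<lambda>z::complex. z ^ m) \<in> \<B>"
    by (rule \<B>_I) (auto intro!: holomorphic_intros simp: norm_power power_le_one)
  moreover have "fps_expansion (\<lambda>z::complex. z ^ m) 0 = fps_X ^ m"
    by (intro fps_expansion_eqI fps_expansion_intros)
  then have "fps_nth (fps_expansion (\<lambda>z::complex. z ^ m) 0) k = (if k = m then 1 else 0)" for k
    by simp
  then have "(deriv ^^ k) (\<lambda>z::complex. z ^ m) 0 = (if k = m then fact k else 0)" for k
    by (simp add: fps_expansion_def divide_eq_eq split: if_splits)
  ultimately show ?thesis by (auto simp: \<B>_ord_def)
qed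

text \<open>For real \<open>a\<close> in \<open>(0, 1)\<close> the Moebius map attains the
  Schwarz-Pick bound at the positive point \<open>r ^ m\<close>, and its coefficients have explicit
  moduli. The functional is then exactly the expression in
  \<open>exists_Moebius_parameter\<close>.\<close>

lemma exists_bohr_sum_gt_1:
  assumes "0 < m" "0 < q" "0 < r" "r < 1" "Psi5 p lam q m r > 0"
  shows "\<exists>f\<in>\<B>. bohr_sum p lam q m f (\<lambda>z. z ^ m) (of_real r) > 1"
proof -
  obtain a where a: "0 < a" "a < 1"
    and gt: "1 < ((r ^ m + a) / (1 + a * r ^ m)) powr p +
      lam * ((1 - a\<^sup>2) * a ^ (q + m - 1) * (r ^ (q + m) / (1 - (a * r) ^ q)))"
    using exists_Moebius_parameter[OF assms] by blast
  define f where "f = (\<lambda>z. (z + of_real a) / (1 + of_real a * z) :: complex)"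
  have f_Moebius: "f = Moebius_function 0 (- of_real a)"
    by (simp add: fun_eq_iff f_def Moebius_function_simple)
  have "f \<in> \<B>"
    unfolding f_Moebius using a
    by (intro \<B>_I Moebius_function_holomorphic less_imp_le Moebius_function_norm_lt_1) auto
  have coeff: "cmod (fps_nth (fps_expansion f 0) (Suc n)) = (1 - a\<^sup>2) * a ^ n" for n
  proof -
    have "fps_nth (fps_expansion f 0) (Suc n) = (1 - (of_real a)\<^sup>2) * (- of_real a) ^ n"
      unfolding f_def by (rule Moebius_fps_nth) (use a in simp)
    moreover have "cmod (1 - (of_real a)\<^sup>2) = 1 - a\<^sup>2"
      using a norm_of_real[of "1 - a\<^sup>2", where 'a = complex] by (simp add: power_le_one)
    ultimately show ?thesis
      using a by (simp add: norm_mult norm_power)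
  qed
  \<comment> \<open>The coefficient of index \<open>Suc n\<close> carries only \<open>a ^ n\<close>;
    the compensating division by \<open>a\<close> makes the sum a geometric series in
    \<open>a * r\<close>.\<close>
  have coeff': "cmod (fps_nth (fps_expansion f 0) (q * Suc k + m)) * cmod (of_real r) ^ (q * Suc k + m) =
      (1 - a\<^sup>2) / a * (a * r) ^ (q * Suc k + m)" for k
  proof -
    obtain n where n: "q * Suc k + m = Suc n"
      using assms(1) by (cases "q * Suc k + m") auto
    show ?thesis
      unfolding n coeff using a assms by (simp add: power_mult_distrib)
  qed
  have ar: "0 \<le> a * r" "a * r < 1"
    using a assms mult_strict_mono[of a 1 r 1] by auto
  have "(\<Sum>k. cmod (fps_nth (fps_expansion f 0) (q * Suc k + m)) * cmod (of_real r) ^ (q * Suc k + m)) =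
      (1 - a\<^sup>2) / a * ((a * r) ^ (q + m) / (1 - (a * r) ^ q))"
    unfolding coeff' using sums_mult[OF sums_gap_geometric[OF ar \<open>0 < q\<close>]] by (rule sums_unique[symmetric])
  also have "\<dots> = (1 - a\<^sup>2) * a ^ (q + m - 1) * (r ^ (q + m) / (1 - (a * r) ^ q))"
  proof -
    obtain n where "q + m = Suc n"
      using assms(1) by (cases "q + m") auto
    then show ?thesis
      using a by (simp add: power_mult_distrib)
  qed
  moreover have "cmod (f (of_real r ^ m)) = (r ^ m + a) / (1 + a * r ^ m)"
  proof -
    have "f (of_real r ^ m) = of_real ((r ^ m + a) / (1 + a * r ^ m))"
      by (simp add: f_def)
    moreover have "0 \<le> (r ^ m + a) / (1 + a * r ^ m)"
      using a assms by simp
    ultimately show ?thesis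
      by (simp only: norm_of_real abs_of_nonneg)
  qed
  ultimately have "bohr_sum p lam q m f (\<lambda>z. z ^ m) (of_real r) > 1"
    using gt by (simp add: bohr_sum_def)
  then show ?thesis using \<open>f \<in> \<B>\<close> by blast
qed

theorem theorem6:
  fixes m q :: nat and p lam :: real
  assumes "q \<ge> 2" and "0 < m" and "m < q"
    and "0 < p" and "p \<le> 2"
    and "0 < lam"
  shows "is_min_root p lam q m (bohr_radius p lam q m) \<and>
    (\<forall>f\<in>\<B>. \<forall>\<omega>\<in>\<B>_ord m. \<forall>z\<in>ball 0 1.
       cmod z \<le> bohr_radius p lam q m \<longrightarrow> bohr_sum p lam q m f \<omega> z \<le> 1) \<and>
    ((\<exists>\<epsilon>>0. \<forall>r\<in>{bohr_radius p lam q m<..<bohr_radius p lam q m + \<epsilon>}. Psi5 p lam q m r > 0) \<longrightarrow>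
       (\<forall>R'\<in>{bohr_radius p lam q m<..1}. \<exists>f\<in>\<B>. \<exists>\<omega>\<in>\<B>_ord m. \<exists>z.
          cmod z < R' \<and> bohr_sum p lam q m f \<omega> z > 1))"
proof -
  define R where "R = bohr_radius p lam q m"
  have q: "0 < q" using assms by simp
  have R: "is_min_root p lam q m R"
    unfolding R_def using assms q by (intro is_min_root_bohr_radius) auto
  then have R01: "0 < R" and root: "Psi5 p lam q m R = 0"
    by (auto simp: is_min_root_def)
  have "\<exists>f\<in>\<B>. \<exists>\<omega>\<in>\<B>_ord m. \<exists>z. cmod z < R' \<and> bohr_sum p lam q m f \<omega> z > 1"
    if R': "R' \<in> {R<..1}" for R'
  proof -
    \<comment> \<open>As \<open>R' \<le> 1\<close>, such an \<open>r\<close> lies in the unit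
      interval beyond the root, where \<open>Psi5\<close> is positive by monotonicity; the point
      \<open>z = r\<close> is the witness.\<close>
    obtain r where r: "R < r" "r < R'"
      using R' dense[of R R'] by auto
    have "Psi5 p lam q m R < Psi5 p lam q m r"
      using r R' R01 assms q by (intro Psi5_strict_mono) auto
    then obtain f where "f \<in> \<B>" "bohr_sum p lam q m f (\<lambda>z. z ^ m) (of_real r) > 1"
      using exists_bohr_sum_gt_1[of m q r p lam] assms q r R' R01 root by auto
    moreover have "cmod (of_real r) < R'"
      using r R01 by simp
    ultimately show ?thesis
      using monomial_in_\<B>_ord by blast
  qed
  then show ?thesis
    using R bohr_sum_le_1[OF \<open>0 < m\<close> q \<open>0 < p\<close> \<open>p \<le> 2\<close> \<open>0 < lam\<close> R]
    unfolding R_def[symmetric] by blast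
qed

end
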